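(* The functions $C_D$ and $C_L$ defined by $$C_D(\alpha)=c_0+2c_1\sin^2(\alpha),\qquad C_L(\alpha)=c_1\sin(2\alpha),$$ with $c_0$ and $c_1$ two real numbers, satisfy the condition $$C_D(\alpha)+C_L(\alpha)\cot(\alpha)=C_{D_0}\qquad\text{with } C_{D_0}=c_0+2c_1 .$$ The equivalent drag force $\vec F_p=-k_aC_{D_0}|\vec v_a|\vec v_a$ and the equivalent thrust intensity $T_p=T+k_a|\vec v_a|^2\,C_L(\alpha)/\sin(\alpha)$, with which the dynamic equation $m\vec a=m\vec g+\vec F_a-T\vec k$ of a symmetric thrust-propelled vehicle having these aerodynamic coefficients is rewritten as $m\vec a=m\vec g+\vec F_p-T_p\vec k$, are then given by $$\vec F_p=-k_a(c_0+2c_1)|\vec v_a|\,\vec v_a,\qquad T_p=T+2c_1k_a|\vec v_a|^2\cos(\alpha).$$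
   Context: $(\vec\imath,\vec\jmath,\vec k)$ is a right-handed orthonormal basis of Euclidean 3-space attached to the vehicle's body, with body-frame origin $G$. The vehicle is symmetric in the sense that its external surface is invariant under every rotation about the axis through $G$ directed by $\vec k$. $m$ is the (constant) mass, $\vec a$ the linear acceleration of the center of mass, $\vec g$ the gravity acceleration vector, and $-T\vec k$ the thrust force, with $T$ the thrust intensity. The air velocity $\vec v_a=v_{a_1}\vec\imath+v_{a_2}\vec\jmath+v_{a_3}\vec k$ is the vehicle's velocity minus the wind velocity. $k_a=\rho\Sigma/2$, with $\rho$ the free stream air density and $\Sigma$ a reference area of the body. The angle of attack $\alpha\in[0,\pi]$ is the angle between $-\vec k$ and $\vec v_a$, and $\beta\in(-\pi,\pi]$ is the angle between $\vec\imath$ and the projection of $\vec v_a$ on the plane spanned by $\vec\imath,\vec\jmath$: $\alpha=\cos^{-1}(-v_{a_3}/|\vec v_a|)$, $\beta=\mathrm{atan2}(v_{a_2},v_{a_1})$, so that $v_{a_1}=|\vec v_a|\sin\alpha\cos\beta$, $v_{a_2}=|\vec v_a|\sin\alpha\sin\beta$, $v_{a_3}=-|\vec v_a|\cos\alpha$. The aerodynamic force is $\vec F_a=\vec F_L+\vec F_D$ with $\vec F_L = k_a|\vec v_a|C_L(\alpha)\,\vec r(\beta)\times \vec v_a$, $\vec F_D=-k_a|\vec v_a|C_D(\alpha)\,\vec v_a$, and $\vec r(\beta)=-\sin(\beta)\vec\imath+\cos(\beta)\vec\jmath$, where $C_D$ and $C_L$ are the drag and lift coefficients; the Reynolds and Mach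 numbers are constant, so that these coefficients depend only on $\alpha$. *)

theory Defs
  imports "HOL-Analysis.Analysis"
begin

definition right_handed_orthonormal :: "real^3 \<Rightarrow> real^3 \<Rightarrow> real^3 \<Rightarrow> bool" where
  "right_handed_orthonormal i j k \<longleftrightarrow>
     norm i = 1 \<and> norm j = 1 \<and> norm k = 1 \<and>
     i \<bullet> j = 0 \<and> j \<bullet> k = 0 \<and> i \<bullet> k = 0 \<and> cross3 i j = k"

text \<open>A rotation about the axis through \<open>G\<close> directed by \<open>k\<close> is \<open>p \<mapsto> G + A (p - G)\<close> with
  \<open>A\<close> a rotation matrix fixing \<open>k\<close>.\<close>

definition rotation_symmetric :: "(real^3) set \<Rightarrow> real^3 \<Rightarrow> real^3 \<Rightarrow> bool" where
  "rotation_symmetric S G k \<longleftrightarrow>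
     (\<forall>A :: real^3^3. rotation_matrix A \<and> A *v k = k \<longrightarrow> (\<lambda>p. G + A *v (p - G)) ` S = S)"

text \<open>At zero air velocity the angle of attack below has the conventional value \<open>pi / 2\<close>. This
  value never matters, because all forces carry a factor \<open>norm va\<close>.\<close>

definition angle_of_attack :: "real^3 \<Rightarrow> real^3 \<Rightarrow> real" where
  "angle_of_attack k va = arccos (- (va \<bullet> k) / norm va)"

text \<open>\<open>Arg (Complex x y)\<close> is \<open>atan2 (y, x)\<close>, with values in \<open>(- pi, pi]\<close> and value 0 at the origin.\<close>

definition sideslip_angle :: "real^3 \<Rightarrow> real^3 \<Rightarrow> real^3 \<Rightarrow> real" where
  "sideslip_angle i j va = Arg (Complex (va \<bullet> i) (va \<bullet> j))"

definition lift_axis :: "real^3 \<Rightarrow> real^3 \<Rightarrow> real \<Rightarrow> real^3" where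
  "lift_axis i j \<beta> = - sin \<beta> *\<^sub>R i + cos \<beta> *\<^sub>R j"

definition lift_force ::
  "real \<Rightarrow> (real \<Rightarrow> real) \<Rightarrow> real^3 \<Rightarrow> real^3 \<Rightarrow> real^3 \<Rightarrow> real^3 \<Rightarrow> real^3" where
  "lift_force ka C\<^sub>L i j k va =
     (ka * norm va * C\<^sub>L (angle_of_attack k va)) *\<^sub>R
       cross3 (lift_axis i j (sideslip_angle i j va)) va"

definition drag_force :: "real \<Rightarrow> (real \<Rightarrow> real) \<Rightarrow> real^3 \<Rightarrow> real^3 \<Rightarrow> real^3" where
  "drag_force ka C\<^sub>D k va = - (ka * norm va * C\<^sub>D (angle_of_attack k va)) *\<^sub>R va"

definition aerodynamic_force ::
  "real \<Rightarrow> (real \<Rightarrow> real) \<Rightarrow> (real \<Rightarrow> real) \<Rightarrow> real^3 \<Rightarrow> real^3 \<Rightarrow> real^3 \<Rightarrow> real^3 \<Rightarrow> real^3" where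
  "aerodynamic_force ka C\<^sub>D C\<^sub>L i j k va = lift_force ka C\<^sub>L i j k va + drag_force ka C\<^sub>D k va"

definition equivalent_drag_force :: "real \<Rightarrow> real \<Rightarrow> real^3 \<Rightarrow> real^3" where
  "equivalent_drag_force ka C\<^sub>D\<^sub>0 va = - (ka * C\<^sub>D\<^sub>0 * norm va) *\<^sub>R va"

text \<open>The quotient \<open>C\<^sub>L(\<alpha>) / sin \<alpha>\<close> on \<open>[0, pi]\<close>, extended to the end points by its limit.
  Division by zero yields 0 in HOL, which would be the wrong value for an air velocity
  parallel to \<open>k\<close>.\<close>

definition lift_sin_quotient :: "(real \<Rightarrow> real) \<Rightarrow> real \<Rightarrow> real" where
  "lift_sin_quotient C\<^sub>L \<alpha> =
     (if sin \<alpha> = 0 then Lim (at \<alpha> within {0..pi}) (\<lambda>x. C\<^sub>L x / sin x) else C\<^sub>L \<alpha> / sin \<alpha>)"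

definition equivalent_thrust ::
  "real \<Rightarrow> real \<Rightarrow> (real \<Rightarrow> real) \<Rightarrow> real^3 \<Rightarrow> real^3 \<Rightarrow> real" where
  "equivalent_thrust T ka C\<^sub>L k va =
     T + ka * (norm va)\<^sup>2 * lift_sin_quotient C\<^sub>L (angle_of_attack k va)"

end

theory Submission
  imports Defs
begin

text \<open>Since \<open>k \<times> v\<^sub>a\<close> equals \<open>|v\<^sub>a| sin \<alpha>\<close> times \<open>r(\<beta>)\<close>, the factor \<open>sin \<alpha>\<close> of \<open>C\<^sub>L(\<alpha>)\<close> turns the lift
  direction into the double cross product \<open>(k \<times> v\<^sub>a) \<times> v\<^sub>a = (v\<^sub>a \<bullet> k) v\<^sub>a - |v\<^sub>a|\<^sup>2 k\<close>. With
  \<open>v\<^sub>a \<bullet> k = - |v\<^sub>a| cos \<alpha>\<close>, the \<open>v\<^sub>a\<close>-part of the lift complements the \<open>sin\<^sup>2 \<alpha>\<close> term of the drag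
  to a constant coefficient, and the \<open>k\<close>-part is the correction to the thrust. The argument
  never divides by \<open>sin \<alpha>\<close>, so it also covers an air velocity that is zero or parallel to \<open>k\<close>.\<close>

text \<open>Where the sine is nonzero, cancelling it in the double-angle formula is enough. At the
  end points the cancelled quotient has a continuous extension, which supplies the limit.\<close>

lemma lift_sin_quotient_sin_double:
  assumes "\<alpha> \<in> {0..pi}"
  shows "lift_sin_quotient (\<lambda>x. c * sin (2 * x)) \<alpha> = 2 * c * cos \<alpha>"
proof (cases "sin \<alpha> = 0")
  case False
  then show ?thesis
    by (simp add: lift_sin_quotient_def sin_double)
next
  case True
  have end_point: "\<alpha> = 0 \<or> \<alpha> = pi"
  proof (rule ccontr)
    assume "\<not> (\<alpha> = 0 \<or> \<alpha> = pi)"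
    then have "sin \<alpha> > 0"
      using assms by (intro sin_gt_zero) auto
    with True show False
      by simp
  qed
  let ?F = "at \<alpha> within {0..pi}"
  \<comment> \<open>Here \<open>\<alpha>\<close> is one end of the interval. The radius
    \<open>pi\<close> excludes the other end, so every point concerned is interior and has positive
    sine.\<close>
  have "eventually (\<lambda>x. c * sin (2 * x) / sin x = 2 * c * cos x) ?F"
    unfolding eventually_at
  proof (intro exI[of _ pi] conjI ballI impI)
    fix x
    assume x: "x \<in> {0..pi}" "x \<noteq> \<alpha> \<and> dist x \<alpha> < pi"
    then have "0 < x" "x < pi"
      using end_point by (auto simp: dist_real_def less_le)
    then have "sin x \<noteq> 0"
      using sin_gt_zero[of x] by simp
    then show "c * sin (2 * x) / sin x = 2 * c * cos x"
      by (simp add: sin_double)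
  qed simp
  moreover have "((\<lambda>x. 2 * c * cos x) \<longlongrightarrow> 2 * c * cos \<alpha>) ?F"
    by (intro tendsto_intros)
  ultimately have "((\<lambda>x. c * sin (2 * x) / sin x) \<longlongrightarrow> 2 * c * cos \<alpha>) ?F"
    by (simp add: tendsto_cong)
  \<comment> \<open>\<open>Lim\<close> is determined by convergence only along a nontrivial filter.
    Here the filter is one-sided, at an end of a nondegenerate interval.\<close>
  moreover have "?F \<noteq> bot"
    using end_point by (auto simp: at_within_Icc_at_right at_within_Icc_at_left)
  ultimately have "Lim ?F (\<lambda>x. c * sin (2 * x) / sin x) = 2 * c * cos \<alpha>"
    by (intro tendsto_Lim)
  with True show ?thesis
    by (simp add: lift_sin_quotient_def)
qed

text \<open>Keeps the argument of \<open>arccos\<close> within its domain, also for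
  \<open>va = 0\<close>, where the quotient is 0.\<close>

lemma abs_inner_div_norm_le_1:
  fixes k va :: "'a::real_inner"
  assumes "norm k = 1"
  shows "\<bar>- (va \<bullet> k) / norm va\<bar> \<le> 1"
  using Cauchy_Schwarz_ineq2[of va k] assms
  by (cases "va = 0") (auto simp: abs_divide)

lemma angle_of_attack_in_range:
  assumes "norm k = 1"
  shows "angle_of_attack k va \<in> {0..pi}"
  using abs_inner_div_norm_le_1[OF assms, of va]
  unfolding angle_of_attack_def atLeastAtMost_iff
  by (intro conjI arccos_lbound arccos_ubound) linarith+

lemma norm_mult_cos_angle_of_attack:
  assumes "norm k = 1"
  shows "norm va * cos (angle_of_attack k va) = - (va \<bullet> k)"
  using abs_inner_div_norm_le_1[OF assms, of va]
  by (cases "va = 0") (simp_all add: angle_of_attack_def cos_arccos_abs)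

text \<open>Both sides are nonnegative, and their squares agree by the Pythagorean identity on the
  left and Lagrange's identity for the norm of a cross product on the right.\<close>

lemma norm_mult_sin_angle_of_attack:
  assumes "norm k = 1"
  shows "norm va * sin (angle_of_attack k va) = norm (cross3 k va)"
proof (rule power2_eq_imp_eq)
  have "(norm va * sin (angle_of_attack k va))\<^sup>2
      = (norm va)\<^sup>2 - (norm va * cos (angle_of_attack k va))\<^sup>2"
    by (simp add: power_mult_distrib sin_squared_eq algebra_simps)
  also have "\<dots> = (norm (cross3 k va))\<^sup>2"
    using norm_cross[of k va] assms
    by (simp add: norm_mult_cos_angle_of_attack inner_commute algebra_simps)
  finally show "(norm va * sin (angle_of_attack k va))\<^sup>2 = (norm (cross3 k va))\<^sup>2" .
  show "0 \<le> norm va * sin (angle_of_attack k va)"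
    using angle_of_attack_in_range[OF assms, of va] by (simp add: sin_ge_zero)
qed simp

text \<open>Orientation enters here: \<open>k\<close> is replaced by \<open>cross3 i j\<close>, and
  the triple product is expanded.\<close>

lemma cross3_axis_eq:
  assumes "right_handed_orthonormal i j k"
  shows "cross3 k va = - (va \<bullet> j) *\<^sub>R i + (va \<bullet> i) *\<^sub>R j"
proof -
  have "cross3 k va = - cross3 va (cross3 i j)"
    using assms cross_skew[of k va] by (simp add: right_handed_orthonormal_def)
  also have "\<dots> = - (va \<bullet> j) *\<^sub>R i + (va \<bullet> i) *\<^sub>R j"
    by (simp add: Lagrange)
  finally show ?thesis .
qed

text \<open>The projection of \<open>va\<close> on the plane of \<open>i\<close> and
  \<open>j\<close>, read as a complex number \<open>z\<close>, has modulus
  \<open>norm (cross3 k va)\<close> and argument the sideslip angle. Its polar form gives the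
  coordinates of \<open>cross3 k va\<close>. For \<open>z = 0\<close> both sides vanish, whatever
  the value of \<open>Arg 0\<close>.\<close>

lemma scaled_lift_axis:
  assumes "right_handed_orthonormal i j k"
  shows "(norm va * sin (angle_of_attack k va)) *\<^sub>R lift_axis i j (sideslip_angle i j va)
    = cross3 k va"
proof -
  define z where "z = Complex (va \<bullet> i) (va \<bullet> j)"
  have ortho: "norm k = 1" "norm i = 1" "norm j = 1" "i \<bullet> j = 0"
    using assms by (auto simp: right_handed_orthonormal_def)
  then have "i \<bullet> i = 1" "j \<bullet> j = 1" "j \<bullet> i = 0"
    by (simp_all add: norm_eq_1 inner_commute)
  then have "norm (cross3 k va) = cmod z"
    unfolding cross3_axis_eq[OF assms] norm_eq_sqrt_inner z_def
    using ortho by (simp add: inner_simps inner_complex_def)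
  moreover have "cmod z * cos (Arg z) = va \<bullet> i" "cmod z * sin (Arg z) = va \<bullet> j"
    using rcis_cmod_Arg[of z] by (auto simp: z_def complex_eq_iff)
  ultimately show ?thesis
    unfolding norm_mult_sin_angle_of_attack[OF ortho(1)] cross3_axis_eq[OF assms]
    by (simp add: lift_axis_def sideslip_angle_def z_def[symmetric] scaleR_diff_right)
qed

text \<open>Both sides are \<open>(k \<times> va) \<times> va\<close>, by the triple product expansion.\<close>

lemma scaled_lift_direction:
  assumes "right_handed_orthonormal i j k"
  shows "(norm va * sin (angle_of_attack k va)) *\<^sub>R
      cross3 (lift_axis i j (sideslip_angle i j va)) va = (va \<bullet> k) *\<^sub>R va - (norm va)\<^sup>2 *\<^sub>R k"
proof -
  have "(norm va * sin (angle_of_attack k va)) *\<^sub>R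
      cross3 (lift_axis i j (sideslip_angle i j va)) va = cross3 (cross3 k va) va"
    by (simp add: scaled_lift_axis[OF assms, symmetric] cross_mult_left)
  also have "\<dots> = - cross3 va (cross3 k va)"
    by (rule cross_skew)
  also have "\<dots> = (va \<bullet> k) *\<^sub>R va - (norm va)\<^sup>2 *\<^sub>R k"
    by (simp add: Lagrange power2_norm_eq_inner)
  finally show ?thesis .
qed

lemma lift_force_sin_double:
  assumes "right_handed_orthonormal i j k"
  shows "lift_force ka (\<lambda>x. c * sin (2 * x)) i j k va =
    - (2 * c * ka * norm va * (cos (angle_of_attack k va))\<^sup>2) *\<^sub>R va
    - (2 * c * ka * (norm va)\<^sup>2 * cos (angle_of_attack k va)) *\<^sub>R k"
proof -
  let ?\<alpha> = "angle_of_attack k va"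
  have "norm k = 1"
    using assms by (simp add: right_handed_orthonormal_def)
  note cos_eq = norm_mult_cos_angle_of_attack[OF this, of va]
  \<comment> \<open>The sine from the double-angle formula and the factor \<open>norm va\<close> of
    the lift are grouped with the cross product, to match
    \<open>scaled_lift_direction\<close>.\<close>
  have "lift_force ka (\<lambda>x. c * sin (2 * x)) i j k va = (2 * c * ka * cos ?\<alpha>) *\<^sub>R
      ((norm va * sin ?\<alpha>) *\<^sub>R cross3 (lift_axis i j (sideslip_angle i j va)) va)"
    unfolding lift_force_def sin_double scaleR_scaleR by (simp add: mult_ac)
  also have "\<dots> = (2 * c * ka * cos ?\<alpha>) *\<^sub>R
      (- (norm va * cos ?\<alpha>) *\<^sub>R va - (norm va)\<^sup>2 *\<^sub>R k)"
    by (simp only: scaled_lift_direction[OF assms] cos_eq minus_minus)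
  finally show ?thesis
    by (simp add: scaleR_diff_right power2_eq_square mult_ac)
qed

theorem proposition2:
  fixes i j k G g a v w va :: "real^3"
    and surf :: "(real^3) set"
    and m T \<rho> \<Sigma> ka c\<^sub>0 c\<^sub>1 C\<^sub>D\<^sub>0 :: real
    and C\<^sub>D C\<^sub>L :: "real \<Rightarrow> real"
  assumes "right_handed_orthonormal i j k"
    and "rotation_symmetric surf G k"
    and "va = v - w"
    and "ka = \<rho> * \<Sigma> / 2"
    and "C\<^sub>D = (\<lambda>\<alpha>. c\<^sub>0 + 2 * c\<^sub>1 * (sin \<alpha>)\<^sup>2)"
    and "C\<^sub>L = (\<lambda>\<alpha>. c\<^sub>1 * sin (2 * \<alpha>))"
    and "C\<^sub>D\<^sub>0 = c\<^sub>0 + 2 * c\<^sub>1"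
  shows "(\<forall>\<alpha>. sin \<alpha> \<noteq> 0 \<longrightarrow> C\<^sub>D \<alpha> + C\<^sub>L \<alpha> * cot \<alpha> = C\<^sub>D\<^sub>0) \<and>
    (m *\<^sub>R a = m *\<^sub>R g + aerodynamic_force ka C\<^sub>D C\<^sub>L i j k va - T *\<^sub>R k \<longleftrightarrow>
     m *\<^sub>R a = m *\<^sub>R g + equivalent_drag_force ka C\<^sub>D\<^sub>0 va - equivalent_thrust T ka C\<^sub>L k va *\<^sub>R k) \<and>
    equivalent_drag_force ka C\<^sub>D\<^sub>0 va = - (ka * (c\<^sub>0 + 2 * c\<^sub>1) * norm va) *\<^sub>R va \<and>
    equivalent_thrust T ka C\<^sub>L k va =
      T + 2 * c\<^sub>1 * ka * (norm va)\<^sup>2 * cos (angle_of_attack k va)"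
proof -
  let ?\<alpha> = "angle_of_attack k va"
  have k: "norm k = 1"
    using assms(1) by (simp add: right_handed_orthonormal_def)
  have coeff: "C\<^sub>D \<alpha> + C\<^sub>L \<alpha> * cot \<alpha> = C\<^sub>D\<^sub>0" if "sin \<alpha> \<noteq> 0" for \<alpha>
  proof -
    have "C\<^sub>D \<alpha> + C\<^sub>L \<alpha> * cot \<alpha> = c\<^sub>0 + 2 * c\<^sub>1 * ((sin \<alpha>)\<^sup>2 + (cos \<alpha>)\<^sup>2)"
      using that by (simp add: assms(5,6) cot_def sin_double power2_eq_square distrib_left)
    then show ?thesis
      by (simp add: assms(7))
  qed
  have thrust: "equivalent_thrust T ka C\<^sub>L k va = T + 2 * c\<^sub>1 * ka * (norm va)\<^sup>2 * cos ?\<alpha>"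
    unfolding equivalent_thrust_def assms(6)
      lift_sin_quotient_sin_double[OF angle_of_attack_in_range[OF k]] by simp
  have drag: "equivalent_drag_force ka C\<^sub>D\<^sub>0 va = - (ka * (c\<^sub>0 + 2 * c\<^sub>1) * norm va) *\<^sub>R va"
    by (simp add: equivalent_drag_force_def assms(7))
  have "aerodynamic_force ka C\<^sub>D C\<^sub>L i j k va =
      (- (2 * c\<^sub>1 * ka * norm va * (cos ?\<alpha>)\<^sup>2)
        - ka * norm va * (c\<^sub>0 + 2 * c\<^sub>1 * (sin ?\<alpha>)\<^sup>2)) *\<^sub>R va
      - (2 * c\<^sub>1 * ka * (norm va)\<^sup>2 * cos ?\<alpha>) *\<^sub>R k"
    unfolding aerodynamic_force_def drag_force_def assms(5,6) lift_force_sin_double[OF assms(1)]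
      scaleR_left_diff_distrib by simp
  also have "- (2 * c\<^sub>1 * ka * norm va * (cos ?\<alpha>)\<^sup>2)
        - ka * norm va * (c\<^sub>0 + 2 * c\<^sub>1 * (sin ?\<alpha>)\<^sup>2)
      = - (ka * (c\<^sub>0 + 2 * c\<^sub>1) * norm va)"
    by (simp add: sin_squared_eq algebra_simps)
  finally have "aerodynamic_force ka C\<^sub>D C\<^sub>L i j k va - T *\<^sub>R k
      = equivalent_drag_force ka C\<^sub>D\<^sub>0 va - equivalent_thrust T ka C\<^sub>L k va *\<^sub>R k"
    by (simp add: drag thrust scaleR_add_left)
  \<comment> \<open>The right-hand sides of the two dynamic equations are equal as vectors, so
    rewriting makes the two equations identical.\<close>
  then have dynamics: "m *\<^sub>R g + aerodynamic_force ka C\<^sub>D C\<^sub>L i j k va - T *\<^sub>R k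
      = m *\<^sub>R g + equivalent_drag_force ka C\<^sub>D\<^sub>0 va - equivalent_thrust T ka C\<^sub>L k va *\<^sub>R k"
    by (simp only: add_diff_eq[symmetric])
  show ?thesis
    unfolding dynamics using coeff drag thrust by blast
qed

end
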